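(* For $x\in V^-$ let $\bar\theta(x)=\big\langle\sum_{l=0}^{\sigma}\mathbf 1_x(x_l)\big\rangle$ be the average number of times the nonreactive trajectories visit $x$. Then, for every $x\in V^-$, $$\bar\theta(x)=\mu(x)\mathbf 1_A(x)+\sum_{y\in V^-}\bar\theta(y)\,\bar p(x\,|\,y),$$ where $\bar p(x\,|\,y)=\dfrac{p(x\,|\,y)(1-q(x))}{1-q(y)}$ for $x,y\in V^-$.
   Context: $V=\{1,\dots,n\}$ with $n>1$; $p(y\,|\,x)$, $x,y\in V$, is the probability that a discrete-time Markov chain $(x_k)_{k\ge0}$ on $V$ jumps from $x$ to $y$ (so $\sum_{y}p(y\,|\,x)=1$). $A,B\subset V$ are disjoint and nonempty, complements are taken in $V$, and $\mu$ is a probability distribution on $A$. For $x\in V$, a set $A$ (resp. $B$) is reachable from $x$ if there is a finite path $x_0=x,x_1,\dots,x_k$, $k\ge0$, with $x_k\in A$ (resp. $x_k\in B$), $x_l\in(A\cup B)^c$ for $1\le l\le k-1$, and $p(x_{l+1}\,|\,x_l)>0$ for $0\le l\le k-1$. Standing assumption: $(A\cup B)^c\ne\emptyset$; from each $x\in(A\cup B)^c$ either $A$ or $B$ is reachable; and $B$ is reachable from each $x\in A$. $\tau_A=\min\{k\ge0:x_k\in A\}$, $\tau_B=\min\{k\ge 0:x_k\in B\}$ ($+\infty$ if never reached), with subscript $x$ when $x_0=x$. Committor: $q(x)=\mathbb P(\tau_{B,x}<\tau_{A,x})$, $x\in V$. For $x_0\in A$, the last hitting time of $A$ is $\sigma=\max\{l: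 x_l\in A,\ 0\le l<\tau_B\}$, and the nonreactive trajectory is $(x_0,\dots,x_\sigma)$. $V^-=\{x\in V: q(x)<1\}$. $\langle\cdot\rangle$ denotes expectation over first passage paths $(x_0,\dots,x_{\tau_B})$ of the chain with $x_0\sim\mu$; $\mathbf 1_x$ is the indicator of $\{x\}$. *)

theory Defs
  imports "HOL-Probability.Probability" "HOL-Library.Extended_Nat"
begin

text \<open>
  Transition probabilities are given by \<open>p :: 's \<Rightarrow> 's pmf\<close>: \<open>pmf (p x) y\<close> is the probability
  of a jump from \<open>x\<close> to \<open>y\<close>, usually written $p(y\,|\,x)$.
\<close>

definition markov_chain ::
  "'s set \<Rightarrow> ('s \<Rightarrow> 's pmf) \<Rightarrow> 's pmf \<Rightarrow> 'w measure \<Rightarrow> (nat \<Rightarrow> 'w \<Rightarrow> 's) \<Rightarrow> bool" where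
  "markov_chain V p \<nu> M X \<longleftrightarrow>
     prob_space M \<and>
     (\<forall>k. X k \<in> measurable M (count_space V)) \<and>
     (\<forall>x\<in>V. \<P>(\<omega> in M. X 0 \<omega> = x) = pmf \<nu> x) \<and>
     (\<forall>k x y. (\<forall>i\<le>k. x i \<in> V) \<longrightarrow> y \<in> V \<longrightarrow> \<P>(\<omega> in M. \<forall>i\<le>k. X i \<omega> = x i) > 0 \<longrightarrow>
        \<P>(\<omega> in M. X (Suc k) \<omega> = y \<bar> \<forall>i\<le>k. X i \<omega> = x i) = pmf (p (x k)) y)"

definition reachable :: "'s set \<Rightarrow> ('s \<Rightarrow> 's pmf) \<Rightarrow> 's set \<Rightarrow> 's set \<Rightarrow> 's set \<Rightarrow> 's \<Rightarrow> bool" where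
  "reachable V p A B S x \<longleftrightarrow>
     (\<exists>k w. w 0 = x \<and> w k \<in> S \<and>
        (\<forall>l. 1 \<le> l \<and> l < k \<longrightarrow> w l \<in> V - (A \<union> B)) \<and>
        (\<forall>l<k. pmf (p (w l)) (w (Suc l)) > 0))"

text \<open>The infimum of the empty set is \<open>\<infinity>\<close>.\<close>

definition hitting_time :: "'s set \<Rightarrow> (nat \<Rightarrow> 's) \<Rightarrow> enat" where
  "hitting_time S w = Inf (enat ` {k. w k \<in> S})"

text \<open>
  Meant for trajectories with \<open>w 0 \<in> A\<close> and \<open>A \<inter> B = {}\<close> that reach \<open>B\<close>, so that the set is
  nonempty and finite; otherwise the value of \<open>Max\<close> is unspecified.
\<close>

definition last_hitting_time :: "'s set \<Rightarrow> 's set \<Rightarrow> (nat \<Rightarrow> 's) \<Rightarrow> nat" where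
  "last_hitting_time A B w = Max {l. w l \<in> A \<and> enat l < hitting_time B w}"

text \<open>
  \<open>N x\<close> and \<open>Y x\<close> are a probability space and a chain on it started at \<open>x\<close>.
\<close>

definition committor ::
  "'s set \<Rightarrow> 's set \<Rightarrow> ('s \<Rightarrow> 'w measure) \<Rightarrow> ('s \<Rightarrow> nat \<Rightarrow> 'w \<Rightarrow> 's) \<Rightarrow> 's \<Rightarrow> real" where
  "committor A B N Y x =
     \<P>(\<omega> in N x. hitting_time B (\<lambda>k. Y x k \<omega>) < hitting_time A (\<lambda>k. Y x k \<omega>))"

definition mean_nonreactive_visits ::
  "'s set \<Rightarrow> 's set \<Rightarrow> 'w measure \<Rightarrow> (nat \<Rightarrow> 'w \<Rightarrow> 's) \<Rightarrow> 's \<Rightarrow> real" where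
  "mean_nonreactive_visits A B M X x =
     (\<integral>\<omega>. (\<Sum>l=0..last_hitting_time A B (\<lambda>k. X k \<omega>). indicator {x} (X l \<omega>)) \<partial>M)"

end

theory Submission
  imports Defs
begin

text \<open>
  A time \<open>l\<close> counts towards the nonreactive trajectory iff \<open>l < \<tau>\<^sub>B\<close> and the path after \<open>l\<close> hits
  \<open>A\<close> before \<open>B\<close>. By the Markov property \<open>\<theta> x = G x * (1 - q x)\<close>, where \<open>G x\<close> is the expected
  number of visits to \<open>x\<close> before \<open>\<tau>\<^sub>B\<close>; it is finite since \<open>B\<close> is reached from every state, so that
  \<open>\<tau>\<^sub>B\<close> has geometric tails. A first-step decomposition gives
  \<open>G x = \<mu> x + (\<Sum>y\<in>V - B. G y * pmf (p y) x)\<close>, and multiplying by \<open>1 - q x\<close> yields the claim: a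
  state \<open>y\<close> outside \<open>B\<close> with \<open>q y = 1\<close> contributes nothing, because it only jumps to states \<open>x\<close>
  with \<open>q x = 1\<close>.
\<close>

section \<open>Events on path space\<close>

definition hits_before :: "'s set \<Rightarrow> 's set \<Rightarrow> (nat \<Rightarrow> 's) \<Rightarrow> bool" where
  "hits_before S T w \<longleftrightarrow> (\<exists>m. w m \<in> S \<and> (\<forall>i\<le>m. w i \<notin> T))"

text \<open>Stands in for measurability with respect to the first \<open>k + 1\<close> coordinates.
  For a chain in a finite \<open>V\<close> such an event is a finite union of cylinders, so no
  measurability of \<open>R\<close> has to be assumed.\<close>

definition determined_by :: "nat \<Rightarrow> ((nat \<Rightarrow> 's) \<Rightarrow> bool) \<Rightarrow> bool" where
  "determined_by k R \<longleftrightarrow> (\<forall>w w'. (\<forall>i\<le>k. w i = w' i) \<longrightarrow> R w = R w')"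

text \<open>Continuity from below; it carries identities for finite-horizon events over to
  \<open>hits_before\<close>.\<close>

lemma (in finite_measure) tendsto_prob_Ex:
  assumes [measurable]: "\<And>n. Measurable.pred M (Q n)"
    and mono: "\<And>n \<omega>. Q n \<omega> \<Longrightarrow> Q (Suc n) \<omega>"
  shows "(\<lambda>n. \<P>(\<omega> in M. Q n \<omega>)) \<longlonglongrightarrow> \<P>(\<omega> in M. \<exists>n. Q n \<omega>)"
proof -
  have "(\<lambda>n. \<P>(\<omega> in M. Q n \<omega>)) \<longlonglongrightarrow> measure M (\<Union>n. {\<omega> \<in> space M. Q n \<omega>})"
    by (intro finite_Lim_measure_incseq incseq_SucI) (auto intro: mono)
  also have "(\<Union>n. {\<omega> \<in> space M. Q n \<omega>}) = {\<omega> \<in> space M. \<exists>n. Q n \<omega>}"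
    by auto
  finally show ?thesis .
qed

lemma determined_byD:
  "determined_by k R \<Longrightarrow> (\<And>i. i \<le> k \<Longrightarrow> w i = w' i) \<Longrightarrow> R w = R w'"
  by (simp add: determined_by_def)

lemma determined_byI:
  assumes "\<And>w w'. (\<And>i. i \<le> k \<Longrightarrow> w i = w' i) \<Longrightarrow> R w \<Longrightarrow> R w'"
  shows "determined_by k R"
  unfolding determined_by_def
proof (intro allI impI)
  fix w w' :: "nat \<Rightarrow> 'a"
  assume "\<forall>i\<le>k. w i = w' i"
  then show "R w = R w'"
    using assms[of w w'] assms[of w' w] by auto
qed

section \<open>Finite-dimensional distributions of a chain on a finite state space\<close>

locale finite_chain =
  fixes V :: "'s set" and p :: "'s \<Rightarrow> 's pmf" and \<nu> :: "'s pmf"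
    and M :: "'w measure" and X :: "nat \<Rightarrow> 'w \<Rightarrow> 's"
  assumes finite_V: "finite V" and chain: "markov_chain V p \<nu> M X"
begin

sublocale prob_space M
  using chain by (simp add: markov_chain_def)

lemma X_measurable_V: "X k \<in> measurable M (count_space V)"
  using chain by (simp add: markov_chain_def)

lemma X_measurable [measurable]: "X k \<in> measurable M (count_space UNIV)"
  using measurable_compose[OF X_measurable_V, of "\<lambda>x. x" "count_space UNIV" k] by simp

lemma X_in_measurable [measurable]: "Measurable.pred M (\<lambda>\<omega>. X k \<omega> \<in> S)"
  by (rule measurable_compose[OF X_measurable]) simp

lemma X_in_V: "\<omega> \<in> space M \<Longrightarrow> X k \<omega> \<in> V"
  using measurable_space[OF X_measurable_V] by simp

lemma prob_X_0: "x \<in> V \<Longrightarrow> \<P>(\<omega> in M. X 0 \<omega> = x) = pmf \<nu> x"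
  using chain by (simp add: markov_chain_def)

text \<open>Finiteness of \<open>V\<close> leaves finitely many words over the times
  \<open>0..k\<close>, and their cylinders are disjoint. Identities for cylinders thus extend by
  summation to every event fixed by finitely many times; \<open>C\<close> and the shift
  \<open>j\<close> leave room for conditions at other times.\<close>

lemma prob_eq_sum_paths:
  assumes R: "determined_by k R" and C [measurable]: "Measurable.pred M C"
  shows "\<P>(\<omega> in M. C \<omega> \<and> R (\<lambda>i. X (j + i) \<omega>)) =
    (\<Sum>w | w \<in> PiE {..k} (\<lambda>_. V) \<and> R w. \<P>(\<omega> in M. C \<omega> \<and> (\<forall>i\<le>k. X (j + i) \<omega> = w i)))"
proof -
  let ?W = "{w \<in> PiE {..k} (\<lambda>_. V). R w}"
  let ?c = "\<lambda>w. {\<omega> \<in> space M. C \<omega> \<and> (\<forall>i\<le>k. X (j + i) \<omega> = w i)}"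
  have fin: "finite ?W"
    using finite_PiE[of "{..k}" "\<lambda>_. V"] finite_V by simp
  have "{\<omega> \<in> space M. C \<omega> \<and> R (\<lambda>i. X (j + i) \<omega>)} = (\<Union>w\<in>?W. ?c w)"
  proof (intro equalityI subsetI)
    fix \<omega> assume \<omega>: "\<omega> \<in> {\<omega> \<in> space M. C \<omega> \<and> R (\<lambda>i. X (j + i) \<omega>)}"
    \<comment> \<open>Truncation to \<open>{..k}\<close> puts the path into the extensional function
      space without changing the value of \<open>R\<close>.\<close>
    let ?w = "restrict (\<lambda>i. X (j + i) \<omega>) {..k}"
    have "R ?w = R (\<lambda>i. X (j + i) \<omega>)"
      by (rule determined_byD[OF R]) simp
    then have "?w \<in> ?W" "\<omega> \<in> ?c ?w"
      using \<omega> X_in_V by auto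
    then show "\<omega> \<in> (\<Union>w\<in>?W. ?c w)"
      by blast
  next
    fix \<omega> assume "\<omega> \<in> (\<Union>w\<in>?W. ?c w)"
    then obtain w where w: "w \<in> ?W" "\<omega> \<in> ?c w"
      by blast
    then have "R (\<lambda>i. X (j + i) \<omega>) = R w"
      by (intro determined_byD[OF R]) simp
    with w show "\<omega> \<in> {\<omega> \<in> space M. C \<omega> \<and> R (\<lambda>i. X (j + i) \<omega>)}"
      by auto
  qed
  moreover have "disjoint_family_on ?c ?W"
  proof (unfold disjoint_family_on_def, intro ballI impI)
    fix v w assume vw: "v \<in> ?W" "w \<in> ?W" "v \<noteq> w"
    then obtain i where "i \<le> k" "v i \<noteq> w i"
      using PiE_ext[of v "{..k}" "\<lambda>_. V" w] by auto
    then show "?c v \<inter> ?c w = {}"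
      by auto
  qed
  moreover have "?c ` ?W \<subseteq> sets M"
    by auto
  ultimately show ?thesis
    using finite_measure_finite_Union[OF fin] by simp
qed

lemma measurable_determined:
  assumes R: "determined_by k R"
  shows "Measurable.pred M (\<lambda>\<omega>. R (\<lambda>i. X (j + i) \<omega>))"
proof -
  have "R (\<lambda>i. X (j + i) \<omega>) \<longleftrightarrow>
      (\<exists>w\<in>{w \<in> PiE {..k} (\<lambda>_. V). R w}. \<forall>i\<le>k. X (j + i) \<omega> = w i)" if "\<omega> \<in> space M" for \<omega>
  proof
    assume "R (\<lambda>i. X (j + i) \<omega>)"
    moreover have "R (restrict (\<lambda>i. X (j + i) \<omega>) {..k}) = R (\<lambda>i. X (j + i) \<omega>)"
      by (rule determined_byD[OF R]) simp
    ultimately show "\<exists>w\<in>{w \<in> PiE {..k} (\<lambda>_. V). R w}. \<forall>i\<le>k. X (j + i) \<omega> = w i"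
      using X_in_V[OF that]
      by (intro bexI[of _ "restrict (\<lambda>i. X (j + i) \<omega>) {..k}"]) auto
  next
    assume "\<exists>w\<in>{w \<in> PiE {..k} (\<lambda>_. V). R w}. \<forall>i\<le>k. X (j + i) \<omega> = w i"
    then obtain w where w: "R w" "\<And>i. i \<le> k \<Longrightarrow> X (j + i) \<omega> = w i"
      by blast
    from determined_byD[OF R w(2)] w(1) show "R (\<lambda>i. X (j + i) \<omega>)"
      by simp
  qed
  moreover have "finite {w \<in> PiE {..k} (\<lambda>_. V). R w}"
    using finite_PiE[of "{..k}" "\<lambda>_. V"] finite_V by simp
  then have "Measurable.pred M
      (\<lambda>\<omega>. \<exists>w\<in>{w \<in> PiE {..k} (\<lambda>_. V). R w}. \<forall>i\<le>k. X (j + i) \<omega> = w i)"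
    by (intro pred_intros_finite) auto
  ultimately show ?thesis
    by (subst measurable_cong) auto
qed

text \<open>\<open>markov_chain\<close> prescribes conditional probabilities only for histories of
  positive probability. The product form holds for all histories, as both sides vanish on null
  ones.\<close>

lemma prob_path_step:
  assumes w: "\<forall>i\<le>k. w i \<in> V" and y: "y \<in> V"
  shows "\<P>(\<omega> in M. (\<forall>i\<le>k. X i \<omega> = w i) \<and> X (Suc k) \<omega> = y) =
    \<P>(\<omega> in M. \<forall>i\<le>k. X i \<omega> = w i) * pmf (p (w k)) y"
proof (cases "\<P>(\<omega> in M. \<forall>i\<le>k. X i \<omega> = w i) = 0")
  case True
  have "\<P>(\<omega> in M. (\<forall>i\<le>k. X i \<omega> = w i) \<and> X (Suc k) \<omega> = y) \<le> \<P>(\<omega> in M. \<forall>i\<le>k. X i \<omega> = w i)"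
    by (intro finite_measure_mono) auto
  with True show ?thesis
    by (simp add: measure_le_0_iff)
next
  case False
  then have "\<P>(\<omega> in M. \<forall>i\<le>k. X i \<omega> = w i) > 0"
    by (simp add: zero_less_measure_iff)
  then have "\<P>(\<omega> in M. X (Suc k) \<omega> = y \<bar> \<forall>i\<le>k. X i \<omega> = w i) = pmf (p (w k)) y"
    using chain w y unfolding markov_chain_def by blast
  with False show ?thesis
    by (simp add: cond_prob_def field_simps conj_commute)
qed

text \<open>The definition of the chain conditions on a complete history. Summing over the histories
  in \<open>E\<close> that end in \<open>x\<close> yields an arbitrary past event, because the
  transition factor depends on \<open>x\<close> alone.\<close>

lemma prob_step:
  assumes E: "determined_by k E" and x: "x \<in> V" and y: "y \<in> V"
  shows "\<P>(\<omega> in M. E (\<lambda>i. X i \<omega>) \<and> X k \<omega> = x \<and> X (Suc k) \<omega> = y) =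
    \<P>(\<omega> in M. E (\<lambda>i. X i \<omega>) \<and> X k \<omega> = x) * pmf (p x) y"
proof -
  let ?R = "\<lambda>w. E w \<and> w k = x"
  let ?W = "{w \<in> PiE {..k} (\<lambda>_. V). ?R w}"
  have R: "determined_by k ?R"
  proof (rule determined_byI)
    fix u v :: "nat \<Rightarrow> 's"
    assume eq: "\<And>i. i \<le> k \<Longrightarrow> u i = v i"
    then have "E u = E v"
      by (rule determined_byD[OF E])
    then show "?R u \<Longrightarrow> ?R v"
      using eq[of k] by simp
  qed
  have "\<P>(\<omega> in M. E (\<lambda>i. X i \<omega>) \<and> X k \<omega> = x \<and> X (Suc k) \<omega> = y) =
      \<P>(\<omega> in M. X (Suc k) \<omega> = y \<and> ?R (\<lambda>i. X (0 + i) \<omega>))"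
    by (simp add: conj_ac)
  also have "\<dots> = (\<Sum>w\<in>?W. \<P>(\<omega> in M. X (Suc k) \<omega> = y \<and> (\<forall>i\<le>k. X (0 + i) \<omega> = w i)))"
    by (rule prob_eq_sum_paths[OF R]) simp
  also have "\<dots> = (\<Sum>w\<in>?W. \<P>(\<omega> in M. True \<and> (\<forall>i\<le>k. X (0 + i) \<omega> = w i)) * pmf (p x) y)"
  proof (rule sum.cong)
    fix w assume "w \<in> ?W"
    then have "\<forall>i\<le>k. w i \<in> V" "w k = x"
      by (auto simp: PiE_iff)
    with prob_path_step[of k w y] y
    show "\<P>(\<omega> in M. X (Suc k) \<omega> = y \<and> (\<forall>i\<le>k. X (0 + i) \<omega> = w i)) =
        \<P>(\<omega> in M. True \<and> (\<forall>i\<le>k. X (0 + i) \<omega> = w i)) * pmf (p x) y"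
      by (simp add: conj_commute)
  qed simp
  also have "\<dots> = \<P>(\<omega> in M. True \<and> ?R (\<lambda>i. X (0 + i) \<omega>)) * pmf (p x) y"
    by (subst prob_eq_sum_paths[OF R]) (simp_all add: sum_distrib_right)
  finally show ?thesis
    by simp
qed

text \<open>Iterates the one-step rule: the part of the path already followed is absorbed into the
  past event, which is then determined by time \<open>k + m\<close>.\<close>

lemma prob_path_from:
  assumes E: "determined_by k E" and w: "\<forall>i\<le>m. w i \<in> V"
  shows "\<P>(\<omega> in M. (E (\<lambda>i. X i \<omega>) \<and> X k \<omega> = w 0) \<and> (\<forall>i\<le>m. X (k + i) \<omega> = w i)) =
    \<P>(\<omega> in M. E (\<lambda>i. X i \<omega>) \<and> X k \<omega> = w 0) * (\<Prod>i<m. pmf (p (w i)) (w (Suc i)))"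
  using w
proof (induction m)
  case 0
  then show ?case
    by (auto intro!: arg_cong[where f = "measure M"])
next
  case (Suc m)
  let ?E = "\<lambda>v. (E v \<and> v k = w 0) \<and> (\<forall>i\<le>m. v (k + i) = w i)"
  have "determined_by (k + m) ?E"
    unfolding determined_by_def
  proof (intro allI impI)
    fix u v :: "nat \<Rightarrow> 's" assume eq: "\<forall>i\<le>k + m. u i = v i"
    then have "E u = E v"
      by (intro determined_byD[OF E]) simp
    with eq show "?E u = ?E v"
      by auto
  qed
  from prob_step[OF this, of "w m" "w (Suc m)"] Suc.prems
  have "\<P>(\<omega> in M. ?E (\<lambda>i. X i \<omega>) \<and> X (k + m) \<omega> = w m \<and> X (Suc (k + m)) \<omega> = w (Suc m)) =
     \<P>(\<omega> in M. ?E (\<lambda>i. X i \<omega>) \<and> X (k + m) \<omega> = w m) * pmf (p (w m)) (w (Suc m))"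
    by simp
  moreover have "{\<omega> \<in> space M. ?E (\<lambda>i. X i \<omega>) \<and> X (k + m) \<omega> = w m} =
      {\<omega> \<in> space M. ?E (\<lambda>i. X i \<omega>)}"
    by auto
  moreover have "{\<omega> \<in> space M. ?E (\<lambda>i. X i \<omega>) \<and> X (k + m) \<omega> = w m \<and> X (Suc (k + m)) \<omega> = w (Suc m)} =
      {\<omega> \<in> space M. (E (\<lambda>i. X i \<omega>) \<and> X k \<omega> = w 0) \<and> (\<forall>i\<le>Suc m. X (k + i) \<omega> = w i)}"
    by (auto simp: le_Suc_eq)
  ultimately show ?case
    using Suc by simp
qed

end

section \<open>The Markov property\<close>

text \<open>\<open>Y\<close>, possibly on another probability space, represents the future of \<open>X\<close> after a visit to
  \<open>x\<close>.\<close>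

locale restarted_chain = finite_chain V p \<nu> M X + Y: finite_chain V p "return_pmf x" N Y
  for V :: "'s set" and p \<nu> and M :: "'w measure" and X and x and N :: "'v measure" and Y +
  assumes x_in_V: "x \<in> V"
begin

text \<open>Both sides are sums over words \<open>w\<close> on the times \<open>0..m\<close>. A word
  starting in \<open>x\<close> receives the same product of transition probabilities from
  \<open>X\<close> after time \<open>k\<close> as from \<open>Y\<close> after time \<open>0\<close>;
  a word starting elsewhere contributes zero to both.\<close>

lemma markov_property:
  assumes E: "determined_by k E" and Q: "determined_by m Q"
  shows "\<P>(\<omega> in M. (E (\<lambda>i. X i \<omega>) \<and> X k \<omega> = x) \<and> Q (\<lambda>i. X (k + i) \<omega>)) =
    \<P>(\<omega> in M. E (\<lambda>i. X i \<omega>) \<and> X k \<omega> = x) * \<P>(\<omega> in N. Q (\<lambda>i. Y i \<omega>))"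
proof -
  let ?W = "{w \<in> PiE {..m} (\<lambda>_. V). Q w}"
  let ?C = "\<lambda>\<omega>. E (\<lambda>i. X i \<omega>) \<and> X k \<omega> = x"
  have [measurable]: "Measurable.pred M (\<lambda>\<omega>. E (\<lambda>i. X i \<omega>))"
    using measurable_determined[OF E, of 0] by simp
  have "\<P>(\<omega> in M. ?C \<omega> \<and> Q (\<lambda>i. X (k + i) \<omega>)) =
      (\<Sum>w\<in>?W. \<P>(\<omega> in M. ?C \<omega> \<and> (\<forall>i\<le>m. X (k + i) \<omega> = w i)))"
    by (rule prob_eq_sum_paths[OF Q]) measurable
  also have "\<dots> = (\<Sum>w\<in>?W. \<P>(\<omega> in M. ?C \<omega>) *
      \<P>(\<omega> in N. True \<and> (\<forall>i\<le>m. Y (0 + i) \<omega> = w i)))"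
  proof (rule sum.cong)
    fix w assume "w \<in> ?W"
    then have w: "\<forall>i\<le>m. w i \<in> V"
      by (auto simp: PiE_iff)
    \<comment> \<open>With a trivial past at time \<open>0\<close>, the path formula gives the law
      of \<open>Y\<close> itself.\<close>
    have T: "determined_by 0 (\<lambda>_. True)"
      by (simp add: determined_by_def)
    show "\<P>(\<omega> in M. ?C \<omega> \<and> (\<forall>i\<le>m. X (k + i) \<omega> = w i)) =
        \<P>(\<omega> in M. ?C \<omega>) * \<P>(\<omega> in N. True \<and> (\<forall>i\<le>m. Y (0 + i) \<omega> = w i))"
    proof (cases "w 0 = x")
      case True
      have "{\<omega> \<in> space N. Y 0 \<omega> = w 0 \<and> (\<forall>i\<le>m. Y i \<omega> = w i)} =
          {\<omega> \<in> space N. \<forall>i\<le>m. Y i \<omega> = w i}"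
        by auto
      with prob_path_from[OF E w] Y.prob_path_from[OF T w] Y.prob_X_0[OF x_in_V] True
      show ?thesis
        by simp
    next
      case False
      then have "{\<omega> \<in> space M. ?C \<omega> \<and> (\<forall>i\<le>m. X (k + i) \<omega> = w i)} = {}"
        by force
      then have "\<P>(\<omega> in M. ?C \<omega> \<and> (\<forall>i\<le>m. X (k + i) \<omega> = w i)) = 0"
        by (simp only: measure_empty)
      moreover have "\<P>(\<omega> in N. True \<and> (\<forall>i\<le>m. Y (0 + i) \<omega> = w i)) \<le> \<P>(\<omega> in N. Y 0 \<omega> = w 0)"
        by (intro Y.finite_measure_mono) auto
      moreover have "\<P>(\<omega> in N. Y 0 \<omega> = w 0) = 0"
        using Y.prob_X_0[of "w 0"] w False by simp
      ultimately show ?thesis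
        by (simp add: measure_le_0_iff)
    qed
  qed simp
  also have "\<dots> = \<P>(\<omega> in M. ?C \<omega>) * \<P>(\<omega> in N. True \<and> Q (\<lambda>i. Y (0 + i) \<omega>))"
    by (subst Y.prob_eq_sum_paths[OF Q]) (simp_all add: sum_distrib_left)
  finally show ?thesis
    by simp
qed

text \<open>\<open>hits_before\<close> looks arbitrarily far ahead and is not fixed by finitely many
  times. The events \<open>Q n\<close>, which require the hit by time \<open>n\<close>, increase to
  it, and uniqueness of limits identifies the two sides.\<close>

lemma markov_property_hits_before:
  assumes E: "determined_by k E"
  shows "\<P>(\<omega> in M. (E (\<lambda>i. X i \<omega>) \<and> X k \<omega> = x) \<and> hits_before S T (\<lambda>i. X (k + i) \<omega>)) =
    \<P>(\<omega> in M. E (\<lambda>i. X i \<omega>) \<and> X k \<omega> = x) * \<P>(\<omega> in N. hits_before S T (\<lambda>i. Y i \<omega>))"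
proof -
  let ?C = "\<lambda>\<omega>. E (\<lambda>i. X i \<omega>) \<and> X k \<omega> = x"
  define Q :: "nat \<Rightarrow> (nat \<Rightarrow> 's) \<Rightarrow> bool"
    where "Q n w \<longleftrightarrow> (\<exists>m\<le>n. w m \<in> S \<and> (\<forall>i\<le>m. w i \<notin> T))" for n w
  have [measurable]: "Measurable.pred M (\<lambda>\<omega>. E (\<lambda>i. X i \<omega>))"
    using measurable_determined[OF E, of 0] by simp
  have QX [measurable]: "Measurable.pred M (\<lambda>\<omega>. Q n (\<lambda>i. X (k + i) \<omega>))" for n
    unfolding Q_def by measurable
  have QY [measurable]: "Measurable.pred N (\<lambda>\<omega>. Q n (\<lambda>i. Y i \<omega>))" for n
    unfolding Q_def by measurable
  have Q: "determined_by n (Q n)" for n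
  proof (rule determined_byI)
    fix u v :: "nat \<Rightarrow> 's"
    assume eq: "\<And>i. i \<le> n \<Longrightarrow> u i = v i" and "Q n u"
    then obtain m where m: "m \<le> n" "u m \<in> S" "\<forall>i\<le>m. u i \<notin> T"
      unfolding Q_def by blast
    then have "u i = v i" if "i \<le> m" for i
      using eq that by simp
    with m show "Q n v"
      unfolding Q_def by (intro exI[of _ m]) auto
  qed
  have mono: "Q n w \<Longrightarrow> Q (Suc n) w" for n w
    unfolding Q_def using le_SucI by blast
  have ex: "(\<exists>n. Q n w) \<longleftrightarrow> hits_before S T w" for w
    unfolding hits_before_def Q_def by auto
  have "(\<lambda>n. \<P>(\<omega> in M. ?C \<omega> \<and> Q n (\<lambda>i. X (k + i) \<omega>))) \<longlonglongrightarrow>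
      \<P>(\<omega> in M. \<exists>n. ?C \<omega> \<and> Q n (\<lambda>i. X (k + i) \<omega>))"
    by (rule tendsto_prob_Ex) (measurable, use mono in auto)
  then have X: "(\<lambda>n. \<P>(\<omega> in M. ?C \<omega> \<and> Q n (\<lambda>i. X (k + i) \<omega>))) \<longlonglongrightarrow>
      \<P>(\<omega> in M. ?C \<omega> \<and> hits_before S T (\<lambda>i. X (k + i) \<omega>))"
    by (simp only: ex ex_simps)
  have "(\<lambda>n. \<P>(\<omega> in N. Q n (\<lambda>i. Y i \<omega>))) \<longlonglongrightarrow>
      \<P>(\<omega> in N. \<exists>n. Q n (\<lambda>i. Y i \<omega>))"
    by (rule Y.tendsto_prob_Ex) (measurable, use mono in auto)
  then have "(\<lambda>n. \<P>(\<omega> in N. Q n (\<lambda>i. Y i \<omega>))) \<longlonglongrightarrow>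
      \<P>(\<omega> in N. hits_before S T (\<lambda>i. Y i \<omega>))"
    by (simp only: ex)
  from tendsto_mult_left[OF this, of "\<P>(\<omega> in M. ?C \<omega>)"]
  have "(\<lambda>n. \<P>(\<omega> in M. ?C \<omega> \<and> Q n (\<lambda>i. X (k + i) \<omega>))) \<longlonglongrightarrow>
      \<P>(\<omega> in M. ?C \<omega>) * \<P>(\<omega> in N. hits_before S T (\<lambda>i. Y i \<omega>))"
    by (simp only: markov_property[OF E Q])
  with X show ?thesis
    by (rule LIMSEQ_unique)
qed

end

section \<open>Hitting times as path events\<close>

lemma less_hitting_time_iff: "enat l < hitting_time S w \<longleftrightarrow> (\<forall>i\<le>l. w i \<notin> S)"
proof
  assume l: "enat l < hitting_time S w"
  show "\<forall>i\<le>l. w i \<notin> S"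
  proof (intro allI impI notI)
    fix i assume "i \<le> l" "w i \<in> S"
    then have "hitting_time S w \<le> enat i"
      unfolding hitting_time_def by (intro Inf_lower) auto
    also have "\<dots> \<le> enat l"
      using \<open>i \<le> l\<close> by simp
    finally show False
      using l by simp
  qed
next
  assume w: "\<forall>i\<le>l. w i \<notin> S"
  \<comment> \<open>Passing to \<open>Suc l\<close> turns the strict inequality into a lower bound
    for the infimum, which also covers the empty set with value \<infinity>.\<close>
  have "enat (Suc l) \<le> hitting_time S w"
    unfolding hitting_time_def
  proof (rule Inf_greatest)
    fix e assume "e \<in> enat ` {k. w k \<in> S}"
    with w show "enat (Suc l) \<le> e"
      using not_less_eq_eq by auto
  qed
  then show "enat l < hitting_time S w"
    by (simp add: Suc_ile_eq)
qed

text \<open>A strict inequality forces the left-hand time to be finite, so the infimum is attained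
  and serves as the witness in \<open>hits_before\<close>. If both times are infinite, both sides
  are false.\<close>

lemma hitting_time_less_iff: "hitting_time S w < hitting_time T w \<longleftrightarrow> hits_before S T w"
proof
  assume less: "hitting_time S w < hitting_time T w"
  then obtain m where m: "hitting_time S w = enat m"
    by (cases "hitting_time S w") auto
  have "{k. w k \<in> S} \<noteq> {}"
  proof
    assume "{k. w k \<in> S} = {}"
    then have "hitting_time S w = \<infinity>"
      by (simp only: hitting_time_def image_empty Inf_empty top_enat_def)
    with m show False
      by simp
  qed
  then have "enat ` {k. w k \<in> S} \<noteq> {}"
    by simp
  then have "Inf (enat ` {k. w k \<in> S}) \<in> enat ` {k. w k \<in> S}"
    by (metis ex_in_conv wellorder_InfI)
  with m have "w m \<in> S"
    by (auto simp: hitting_time_def)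
  moreover have "\<forall>i\<le>m. w i \<notin> T"
    using less m by (simp add: less_hitting_time_iff)
  ultimately show "hits_before S T w"
    unfolding hits_before_def by blast
next
  assume "hits_before S T w"
  then obtain m where m: "w m \<in> S" "\<forall>i\<le>m. w i \<notin> T"
    unfolding hits_before_def by blast
  then have "hitting_time S w \<le> enat m"
    unfolding hitting_time_def by (intro Inf_lower) auto
  also have "enat m < hitting_time T w"
    using m by (simp add: less_hitting_time_iff)
  finally show "hitting_time S w < hitting_time T w" .
qed

text \<open>Since \<open>B\<close> is hit, there is a first entrance time \<open>m\<close> into the
  union of \<open>A\<close> and \<open>B\<close>. By disjointness the path is then in exactly one of
  the two sets, and that set is hit first.\<close>

lemma hits_before_or_iff:
  assumes "A \<inter> B = {}" and "w k \<in> B"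
  shows "hits_before A B w \<longleftrightarrow> \<not> hits_before B A w"
proof -
  define m where "m = (LEAST k. w k \<in> A \<union> B)"
  have m: "w m \<in> A \<union> B"
    unfolding m_def using assms(2) by (rule LeastI[OF UnI2])
  have less: "w i \<notin> A \<union> B" if "i < m" for i
    using that unfolding m_def by (rule not_less_Least)
  have "hits_before A B w \<longleftrightarrow> w m \<in> A"
  proof
    assume "hits_before A B w"
    then obtain l where l: "w l \<in> A" "\<forall>i\<le>l. w i \<notin> B"
      unfolding hits_before_def by blast
    then have "m \<le> l"
      using less[of l] by (meson UnI1 not_le)
    with l m show "w m \<in> A"
      by auto
  next
    assume "w m \<in> A"
    then show "hits_before A B w"
      unfolding hits_before_def using less assms(1)
      by (intro exI[of _ m]) (auto simp: le_less)
  qed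
  moreover have "hits_before B A w \<longleftrightarrow> w m \<in> B"
  proof
    assume "hits_before B A w"
    then obtain l where l: "w l \<in> B" "\<forall>i\<le>l. w i \<notin> A"
      unfolding hits_before_def by blast
    then have "m \<le> l"
      using less[of l] by (meson UnI2 not_le)
    with l m show "w m \<in> B"
      by auto
  next
    assume "w m \<in> B"
    then show "hits_before B A w"
      unfolding hits_before_def using less assms(1)
      by (intro exI[of _ m]) (auto simp: le_less)
  qed
  ultimately show ?thesis
    using m assms(1) by blast
qed

text \<open>The time \<open>l\<close> precedes the last visit to \<open>A\<close> before \<open>B\<close> iff, after \<open>l\<close>, the path hits \<open>A\<close>
  before \<open>B\<close>; unlike \<open>last_hitting_time\<close>, this is accessible to the Markov property.\<close>

lemma sum_upto_last_hitting_time: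
  assumes "A \<inter> B = {}" "w 0 \<in> A" "w k \<in> B"
  shows "(\<Sum>l=0..last_hitting_time A B w. indicator {x} (w l) :: real) =
    (\<Sum>l. of_bool ((\<forall>i\<le>l. w i \<notin> B) \<and> w l = x \<and> hits_before A B (\<lambda>i. w (l + i))))"
    (is "?lhs = (\<Sum>l. of_bool (?D l))")
    and "finite {l. (\<forall>i\<le>l. w i \<notin> B) \<and> w l = x \<and> hits_before A B (\<lambda>i. w (l + i))}"
proof -
  define L where "L = {l. w l \<in> A \<and> enat l < hitting_time B w}"
  have L: "l \<in> L \<longleftrightarrow> w l \<in> A \<and> (\<forall>i\<le>l. w i \<notin> B)" for l
    by (simp add: L_def less_hitting_time_iff)
  \<comment> \<open>The visit to \<open>B\<close> at time \<open>k\<close> bounds \<open>L\<close>,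
    and time \<open>0\<close> will be seen to belong to it, so \<open>Max L\<close> is a genuine
    maximum.\<close>
  have "L \<subseteq> {..<k}"
    using assms(3) by (auto simp: L not_less[symmetric])
  then have fin: "finite L"
    by (rule finite_subset) simp
  have "0 \<in> L"
    using assms by (auto simp: L)
  then have ne: "L \<noteq> {}"
    by blast
  \<comment> \<open>Forwards, \<open>Max L\<close> is itself a later visit to \<open>A\<close>;
    backwards, hitting \<open>A\<close> at time \<open>l + m\<close> before \<open>B\<close> puts
    \<open>l + m\<close> into \<open>L\<close>.\<close>
  have le: "l \<le> Max L \<longleftrightarrow> (\<forall>i\<le>l. w i \<notin> B) \<and> hits_before A B (\<lambda>i. w (l + i))" for l
  proof
    assume "l \<le> Max L"
    have M: "w (Max L) \<in> A" "\<forall>i\<le>Max L. w i \<notin> B"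
      using Max_in[OF fin ne] by (simp_all add: L)
    with \<open>l \<le> Max L\<close> show "(\<forall>i\<le>l. w i \<notin> B) \<and> hits_before A B (\<lambda>i. w (l + i))"
      unfolding hits_before_def by (intro conjI exI[of _ "Max L - l"]) auto
  next
    assume l: "(\<forall>i\<le>l. w i \<notin> B) \<and> hits_before A B (\<lambda>i. w (l + i))"
    then obtain m where m: "w (l + m) \<in> A" "\<forall>i\<le>m. w (l + i) \<notin> B"
      unfolding hits_before_def by blast
    have "w i \<notin> B" if "i \<le> l + m" for i
    proof (cases "i \<le> l")
      case False
      then show ?thesis
        using m(2) that by (metis add_le_cancel_left le_add_diff_inverse nat_le_linear)
    qed (use l in blast)
    with m have "l + m \<in> L"
      by (simp add: L)
    with fin have "l + m \<le> Max L"
      by (rule Max_ge)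
    then show "l \<le> Max L"
      by simp
  qed
  have D: "?D l \<longleftrightarrow> l \<le> Max L \<and> w l = x" for l
    using le by blast
  show "finite {l. ?D l}"
    unfolding D by (rule finite_subset[of _ "{..Max L}"]) auto
  have "(\<Sum>l. of_bool (?D l)) = (\<Sum>l=0..Max L. of_bool (?D l) :: real)"
    by (rule suminf_finite) (auto simp: D)
  also have "\<dots> = (\<Sum>l=0..Max L. indicator {x} (w l))"
    by (rule sum.cong) (simp_all add: D indicator_def)
  finally show "?lhs = (\<Sum>l. of_bool (?D l))"
    by (simp add: last_hitting_time_def L_def)
qed

section \<open>Initial state and visited states of a chain\<close>

context finite_chain
begin

lemma hits_before_measurable [measurable]:
  "Measurable.pred M (\<lambda>\<omega>. hits_before S T (\<lambda>i. X (k + i) \<omega>))"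
  "Measurable.pred M (\<lambda>\<omega>. hits_before S T (\<lambda>i. X i \<omega>))"
  unfolding hits_before_def by measurable

lemma prob_eq_sum_states:
  assumes [measurable]: "Measurable.pred M C"
  shows "\<P>(\<omega> in M. C \<omega>) = (\<Sum>y\<in>V. \<P>(\<omega> in M. C \<omega> \<and> X k \<omega> = y))"
proof -
  have "{\<omega> \<in> space M. C \<omega>} = (\<Union>y\<in>V. {\<omega> \<in> space M. C \<omega> \<and> X k \<omega> = y})"
    using X_in_V by auto
  moreover have "measure M (\<Union>y\<in>V. {\<omega> \<in> space M. C \<omega> \<and> X k \<omega> = y}) =
      (\<Sum>y\<in>V. \<P>(\<omega> in M. C \<omega> \<and> X k \<omega> = y))"
    by (intro finite_measure_finite_Union finite_V) (auto simp: disjoint_family_on_def)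
  ultimately show ?thesis
    by simp
qed

lemma AE_X_0: "AE \<omega> in M. X 0 \<omega> \<in> set_pmf \<nu>"
proof -
  have "AE \<omega> in M. X 0 \<omega> \<noteq> x" if "x \<in> V - set_pmf \<nu>" for x
    using that prob_X_0[of x] prob_Collect_eq_0[of "\<lambda>\<omega>. X 0 \<omega> = x"]
    by (simp add: set_pmf_iff)
  then have "AE \<omega> in M. \<forall>x\<in>V - set_pmf \<nu>. X 0 \<omega> \<noteq> x"
    using finite_V by (intro AE_finite_allI) auto
  then show ?thesis
    using AE_space by eventually_elim (use X_in_V in blast)
qed

text \<open>Positivity propagates along edges: being in \<open>y\<close> at time \<open>k\<close>
  and then moving to \<open>z\<close> has as its probability a product of two positive factors.
  \<open>closed\<close> keeps the walk inside \<open>V\<close>.\<close>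

lemma prob_visit_pos:
  assumes closed: "\<And>x. x \<in> V \<Longrightarrow> set_pmf (p x) \<subseteq> V"
    and reach: "(x, y) \<in> {(x, y). pmf (p x) y > 0}\<^sup>*" and x: "x \<in> V" "pmf \<nu> x > 0"
  shows "y \<in> V \<and> (\<exists>k. \<P>(\<omega> in M. X k \<omega> = y) > 0)"
  using reach
proof induction
  case base
  then show ?case
    using x prob_X_0 by metis
next
  case (step y z)
  then obtain k where k: "\<P>(\<omega> in M. X k \<omega> = y) > 0" and y: "y \<in> V"
    by blast
  from step have z: "pmf (p y) z > 0" "z \<in> V"
    using closed[OF y] by (auto simp: set_pmf_iff)
  have "determined_by k (\<lambda>_. True)"
    by (simp add: determined_by_def)
  from prob_step[OF this y z(2)]
  have "\<P>(\<omega> in M. X k \<omega> = y \<and> X (Suc k) \<omega> = z) > 0"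
    using k z by simp
  also have "\<P>(\<omega> in M. X k \<omega> = y \<and> X (Suc k) \<omega> = z) \<le> \<P>(\<omega> in M. X (Suc k) \<omega> = z)"
    by (intro finite_measure_mono) auto
  finally show ?case
    using z by blast
qed

end

text \<open>Forgetting which sets the intermediate states avoid leaves plain graph reachability.
  This is transitive, so a path to \<open>A\<close> can be continued by one from \<open>A\<close> to
  \<open>B\<close>.\<close>

lemma reachable_imp_rtrancl:
  assumes "reachable V p A B S x"
  obtains s where "s \<in> S" "(x, s) \<in> {(x, y). pmf (p x) y > 0}\<^sup>*"
proof -
  obtain k w where w: "w 0 = x" "w k \<in> S" "\<forall>l<k. pmf (p (w l)) (w (Suc l)) > 0"
    using assms unfolding reachable_def by blast
  have "(x, w l) \<in> {(x, y). pmf (p x) y > 0}\<^sup>*" if "l \<le> k" for l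
    using that
  proof (induction l)
    case (Suc l)
    then show ?case
      using w(3) by (auto intro: rtrancl_into_rtrancl)
  qed (simp add: w)
  with w that show ?thesis
    by blast
qed

section \<open>The chain killed on entering \<open>B\<close>\<close>

locale transition_setup = finite_chain V p \<nu> M X
  for V :: "'s set" and p \<nu> and M :: "'w measure" and X +
  fixes N :: "'s \<Rightarrow> 'v measure" and Y :: "'s \<Rightarrow> nat \<Rightarrow> 'v \<Rightarrow> 's" and A B :: "'s set"
  assumes closed: "x \<in> V \<Longrightarrow> set_pmf (p x) \<subseteq> V"
    and Y_chain: "x \<in> V \<Longrightarrow> markov_chain V p (return_pmf x) (N x) (Y x)"
    and A_subset: "A \<subseteq> V" and B_subset: "B \<subseteq> V" and disjoint: "A \<inter> B = {}"
    and reach_outside: "x \<in> V - (A \<union> B) \<Longrightarrow> reachable V p A B A x \<or> reachable V p A B B x"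
    and reach_from_A: "x \<in> A \<Longrightarrow> reachable V p A B B x"
begin

lemma finite_chain_Y: "x \<in> V \<Longrightarrow> finite_chain V p (return_pmf x) (N x) (Y x)"
  using Y_chain finite_V by (simp add: finite_chain_def)

lemma restarted: "x \<in> V \<Longrightarrow> restarted_chain V p \<nu> M X x (N x) (Y x)"
  using finite_chain_Y finite_chain_axioms
  by (simp add: restarted_chain_def restarted_chain_axioms_def)

text \<open>The locale leaves the initial distribution arbitrary, so each \<open>Y x\<close> can
  take the place of \<open>X\<close>, and what is proved for \<open>X\<close> becomes available for
  chains started at a point.\<close>

lemma Y_setup: "x \<in> V \<Longrightarrow> transition_setup V p (return_pmf x) (N x) (Y x) N Y A B"
  using finite_chain_Y transition_setup_axioms by (simp add: transition_setup_def)

definition avoid_prob :: "nat \<Rightarrow> real" where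
  "avoid_prob k = \<P>(\<omega> in M. \<forall>i\<le>k. X i \<omega> \<notin> B)"

text \<open>The law at time \<open>k\<close> of the chain killed on entering \<open>B\<close>, a
  measure of total mass \<open>avoid_prob k\<close>.\<close>

definition killed_prob :: "nat \<Rightarrow> 's \<Rightarrow> real" where
  "killed_prob k x = \<P>(\<omega> in M. (\<forall>i\<le>k. X i \<omega> \<notin> B) \<and> X k \<omega> = x)"

definition Y_avoid_prob :: "'s \<Rightarrow> nat \<Rightarrow> real" where
  "Y_avoid_prob x k = \<P>(\<omega> in N x. \<forall>i\<le>k. Y x i \<omega> \<notin> B)"

text \<open>This is one minus the committor, phrased as a hitting event because that is the future
  factor which the Markov property splits off.\<close>

definition return_prob :: "'s \<Rightarrow> real" where
  "return_prob x = \<P>(\<omega> in N x. hits_before A B (\<lambda>i. Y x i \<omega>))"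

lemma determined_by_avoid: "determined_by k (\<lambda>w. \<forall>i\<le>k. w i \<notin> B)"
  by (rule determined_byI) force

lemma avoid_prob_eq_sum: "avoid_prob k = (\<Sum>x\<in>V. killed_prob k x)"
  unfolding avoid_prob_def killed_prob_def by (intro prob_eq_sum_states) measurable

lemma killed_prob_nonneg: "0 \<le> killed_prob k x"
  by (simp add: killed_prob_def)

lemma killed_prob_B: "x \<in> B \<Longrightarrow> killed_prob k x = 0"
proof -
  assume "x \<in> B"
  then have "{\<omega> \<in> space M. (\<forall>i\<le>k. X i \<omega> \<notin> B) \<and> X k \<omega> = x} = {}"
    by auto
  then show ?thesis
    unfolding killed_prob_def by (simp only: measure_empty)
qed

lemma killed_prob_0: "x \<in> V - B \<Longrightarrow> killed_prob 0 x = pmf \<nu> x"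
proof -
  assume x: "x \<in> V - B"
  then have "{\<omega> \<in> space M. (\<forall>i\<le>0. X i \<omega> \<notin> B) \<and> X 0 \<omega> = x} = {\<omega> \<in> space M. X 0 \<omega> = x}"
    by auto
  with x show ?thesis
    by (simp add: killed_prob_def prob_X_0)
qed

text \<open>The forward equation of the killed chain: as \<open>x\<close> lies outside
  \<open>B\<close>, surviving until time \<open>Suc k\<close> in \<open>x\<close> only requires
  surviving until time \<open>k\<close>.\<close>

lemma killed_prob_Suc:
  assumes x: "x \<in> V - B"
  shows "killed_prob (Suc k) x = (\<Sum>y\<in>V. killed_prob k y * pmf (p y) x)"
proof -
  have "{\<omega> \<in> space M. (\<forall>i\<le>Suc k. X i \<omega> \<notin> B) \<and> X (Suc k) \<omega> = x} =
      {\<omega> \<in> space M. (\<forall>i\<le>k. X i \<omega> \<notin> B) \<and> X (Suc k) \<omega> = x}"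
    using x by (auto simp: le_Suc_eq)
  then have "killed_prob (Suc k) x =
      \<P>(\<omega> in M. (\<forall>i\<le>k. X i \<omega> \<notin> B) \<and> X (Suc k) \<omega> = x)"
    by (simp add: killed_prob_def)
  also have "\<dots> =
      (\<Sum>y\<in>V. \<P>(\<omega> in M. ((\<forall>i\<le>k. X i \<omega> \<notin> B) \<and> X (Suc k) \<omega> = x) \<and> X k \<omega> = y))"
    by (rule prob_eq_sum_states) measurable
  also have "\<dots> = (\<Sum>y\<in>V. killed_prob k y * pmf (p y) x)"
  proof (rule sum.cong)
    fix y assume "y \<in> V"
    with prob_step[OF determined_by_avoid, of y x k] x
    show "\<P>(\<omega> in M. ((\<forall>i\<le>k. X i \<omega> \<notin> B) \<and> X (Suc k) \<omega> = x) \<and> X k \<omega> = y) =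
        killed_prob k y * pmf (p y) x"
      by (simp add: killed_prob_def conj_ac)
  qed simp
  finally show ?thesis .
qed

section \<open>Tails of the hitting time of \<open>B\<close>\<close>

lemma reach_B:
  assumes x: "x \<in> V - B"
  shows "\<exists>b\<in>B. (x, b) \<in> {(x, y). pmf (p x) y > 0}\<^sup>*"
proof -
  have from_A: "\<exists>b\<in>B. (a, b) \<in> {(x, y). pmf (p x) y > 0}\<^sup>*" if "a \<in> A" for a
    using reach_from_A[OF that] reachable_imp_rtrancl by metis
  show ?thesis
  proof (cases "x \<in> A")
    case False
    with x reach_outside[of x] consider
        "reachable V p A B A x" | "reachable V p A B B x"
      by blast
    then show ?thesis
    proof cases
      case 1
      then obtain a where a: "a \<in> A" "(x, a) \<in> {(x, y). pmf (p x) y > 0}\<^sup>*"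
        by (rule reachable_imp_rtrancl)
      with from_A[of a] show ?thesis
        by (meson rtrancl_trans)
    next
      case 2
      then show ?thesis
        by (rule reachable_imp_rtrancl) blast
    qed
  qed (rule from_A)
qed

lemma Y_avoid_prob_less_1:
  assumes x: "x \<in> V - B"
  shows "\<exists>k. Y_avoid_prob x k < 1"
proof -
  interpret Y: finite_chain V p "return_pmf x" "N x" "Y x"
    using x by (intro finite_chain_Y) simp
  obtain b where b: "b \<in> B" "(x, b) \<in> {(x, y). pmf (p x) y > 0}\<^sup>*"
    using reach_B[OF x] by blast
  then obtain k where k: "\<P>(\<omega> in N x. Y x k \<omega> = b) > 0"
    using Y.prob_visit_pos[OF closed b(2)] x by auto
  have "Y_avoid_prob x k \<le> \<P>(\<omega> in N x. \<not> Y x k \<omega> = b)"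
    unfolding Y_avoid_prob_def using b by (intro Y.finite_measure_mono) auto
  also have "\<dots> = 1 - \<P>(\<omega> in N x. Y x k \<omega> = b)"
    by (rule Y.prob_neg) simp
  finally show ?thesis
    using k by (intro exI[of _ k]) simp
qed

text \<open>Avoidance probabilities decrease with the horizon, so on the finite set
  \<open>V - B\<close> one horizon beyond all the individual ones serves every state.\<close>

lemma uniform_avoid_bound:
  obtains m r where "0 < m" "0 \<le> r" "r < 1" "\<And>x. x \<in> V - B \<Longrightarrow> Y_avoid_prob x m \<le> r"
proof -
  obtain f where f: "\<And>x. x \<in> V - B \<Longrightarrow> Y_avoid_prob x (f x) < 1"
    using Y_avoid_prob_less_1 by metis
  define m where "m = Suc (\<Sum>x\<in>V. f x)"
  \<comment> \<open>Inserting \<open>0\<close> keeps the maximum defined when \<open>V - B\<close>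
    is empty and gives \<open>0 \<le> r\<close>.\<close>
  define r where "r = Max (insert 0 ((\<lambda>x. Y_avoid_prob x m) ` (V - B)))"
  have less: "Y_avoid_prob x m < 1" if x: "x \<in> V - B" for x
  proof -
    interpret Y: finite_chain V p "return_pmf x" "N x" "Y x"
      using x by (intro finite_chain_Y) simp
    have "f x \<le> m"
      using x finite_V member_le_sum[of x V f] by (simp add: m_def)
    then have "Y_avoid_prob x m \<le> Y_avoid_prob x (f x)"
      unfolding Y_avoid_prob_def by (intro Y.finite_measure_mono) auto
    with f[OF x] show ?thesis
      by simp
  qed
  show thesis
  proof (rule that[of m r])
    show "0 < m"
      by (simp add: m_def)
    show "0 \<le> r"
      unfolding r_def using finite_V by (intro Max_ge) auto
    show "r < 1"
      unfolding r_def using finite_V less by (subst Max_less_iff) auto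
    show "Y_avoid_prob x m \<le> r" if "x \<in> V - B" for x
      unfolding r_def using finite_V that by (intro Max_ge) auto
  qed
qed

text \<open>The Markov property at time \<open>k\<close>: from the state reached, avoiding
  \<open>B\<close> for \<open>m\<close> more steps has probability at most \<open>r\<close>. States
  in \<open>B\<close> carry no killed mass, so the bound is only applied outside
  \<open>B\<close>.\<close>

lemma avoid_prob_add_le:
  assumes r: "\<And>x. x \<in> V - B \<Longrightarrow> Y_avoid_prob x m \<le> r"
  shows "avoid_prob (k + m) \<le> r * avoid_prob k"
proof -
  have "avoid_prob (k + m) \<le>
      \<P>(\<omega> in M. (\<forall>i\<le>k. X i \<omega> \<notin> B) \<and> (\<forall>i\<le>m. X (k + i) \<omega> \<notin> B))"
    unfolding avoid_prob_def by (intro finite_measure_mono) auto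
  also have "\<dots> = (\<Sum>y\<in>V.
      \<P>(\<omega> in M. ((\<forall>i\<le>k. X i \<omega> \<notin> B) \<and> (\<forall>i\<le>m. X (k + i) \<omega> \<notin> B)) \<and> X k \<omega> = y))"
    by (rule prob_eq_sum_states) measurable
  also have "\<dots> \<le> (\<Sum>y\<in>V. r * killed_prob k y)"
  proof (rule sum_mono)
    fix y assume y: "y \<in> V"
    interpret restarted_chain V p \<nu> M X y "N y" "Y y"
      by (rule restarted[OF y])
    have "\<P>(\<omega> in M. ((\<forall>i\<le>k. X i \<omega> \<notin> B) \<and> (\<forall>i\<le>m. X (k + i) \<omega> \<notin> B)) \<and> X k \<omega> = y) =
        killed_prob k y * Y_avoid_prob y m"
      using markov_property[OF determined_by_avoid determined_by_avoid, of k m]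
      by (simp add: killed_prob_def Y_avoid_prob_def conj_ac)
    also have "\<dots> \<le> r * killed_prob k y"
    proof (cases "y \<in> B")
      case False
      with y r show ?thesis
        by (simp add: killed_prob_nonneg mult.commute mult_right_mono)
    qed (simp add: killed_prob_B)
    finally show "\<P>(\<omega> in M. ((\<forall>i\<le>k. X i \<omega> \<notin> B) \<and> (\<forall>i\<le>m. X (k + i) \<omega> \<notin> B)) \<and> X k \<omega> = y)
        \<le> r * killed_prob k y" .
  qed
  also have "\<dots> = r * avoid_prob k"
    by (simp add: avoid_prob_eq_sum sum_distrib_left)
  finally show ?thesis .
qed

text \<open>Shifting a partial sum \<open>S\<close> by a block of length \<open>m\<close> gives
  \<open>S \<le> m + r * S\<close>, hence the common bound \<open>m / (1 - r)\<close>.\<close>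

lemma summable_avoid_prob: "summable avoid_prob"
proof -
  obtain m r where m: "0 < m" "0 \<le> r" "r < 1" and r: "\<And>x. x \<in> V - B \<Longrightarrow> Y_avoid_prob x m \<le> r"
    by (rule uniform_avoid_bound) blast
  have nonneg: "0 \<le> avoid_prob k" for k
    by (simp add: avoid_prob_def)
  have "(\<Sum>k<K. avoid_prob k) \<le> m / (1 - r)" for K
  proof -
    have "(\<Sum>k<K. avoid_prob k) \<le> (\<Sum>k<m + K. avoid_prob k)"
      by (intro sum_mono2) (auto simp: nonneg)
    also have "\<dots> = (\<Sum>k<m. avoid_prob k) + (\<Sum>k<K. avoid_prob (k + m))"
      by (induction K) (simp_all add: add.commute)
    also have "(\<Sum>k<m. avoid_prob k) \<le> m"
      using sum_bounded_above[of "{..<m}" avoid_prob 1] by (simp add: avoid_prob_def)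
    also have "(\<Sum>k<K. avoid_prob (k + m)) \<le> r * (\<Sum>k<K. avoid_prob k)"
      unfolding sum_distrib_left by (intro sum_mono avoid_prob_add_le r)
    finally show ?thesis
      using m by (simp add: field_simps)
  qed
  with nonneg show ?thesis
    by (rule summableI_nonneg_bounded)
qed

lemma summable_killed_prob: "summable (\<lambda>k. killed_prob k x)"
proof (rule summable_comparison_test[OF _ summable_avoid_prob])
  show "\<exists>N. \<forall>n\<ge>N. norm (killed_prob n x) \<le> avoid_prob n"
    unfolding killed_prob_def avoid_prob_def by (auto intro!: finite_measure_mono)
qed

lemma AE_hits_B: "AE \<omega> in M. \<exists>k. X k \<omega> \<in> B"
proof -
  have le: "\<P>(\<omega> in M. \<forall>k. X k \<omega> \<notin> B) \<le> avoid_prob k" for k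
    unfolding avoid_prob_def by (intro finite_measure_mono) auto
  have "avoid_prob \<longlonglongrightarrow> 0"
    using summable_avoid_prob by (rule summable_LIMSEQ_zero)
  then have "\<P>(\<omega> in M. \<forall>k. X k \<omega> \<notin> B) \<le> 0"
    using le by (intro LIMSEQ_le_const) auto
  then have "\<P>(\<omega> in M. \<forall>k. X k \<omega> \<notin> B) = 0"
    by (simp add: measure_le_0_iff)
  then show ?thesis
    by (subst (asm) prob_Collect_eq_0) auto
qed

section \<open>Return probabilities and the committor\<close>

lemma prob_hits_before_swap:
  "\<P>(\<omega> in M. hits_before A B (\<lambda>i. X i \<omega>)) = 1 - \<P>(\<omega> in M. hits_before B A (\<lambda>i. X i \<omega>))"
proof -
  have "\<P>(\<omega> in M. hits_before A B (\<lambda>i. X i \<omega>)) = \<P>(\<omega> in M. \<not> hits_before B A (\<lambda>i. X i \<omega>))"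
  proof (rule finite_measure_eq_AE)
    show "AE \<omega> in M. (\<omega> \<in> {\<omega> \<in> space M. hits_before A B (\<lambda>i. X i \<omega>)}) =
        (\<omega> \<in> {\<omega> \<in> space M. \<not> hits_before B A (\<lambda>i. X i \<omega>)})"
      using AE_hits_B
    proof eventually_elim
      case (elim \<omega>)
      then obtain k where "X k \<omega> \<in> B"
        by blast
      from hits_before_or_iff[OF disjoint, where w = "\<lambda>i. X i \<omega>", OF this]
      show ?case
        by simp
    qed
  qed measurable
  also have "\<dots> = 1 - \<P>(\<omega> in M. hits_before B A (\<lambda>i. X i \<omega>))"
    by (rule prob_neg) measurable
  finally show ?thesis .
qed

lemma return_prob_eq_committor: "x \<in> V \<Longrightarrow> return_prob x = 1 - committor A B N Y x"
proof -
  assume "x \<in> V"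
  then interpret Y: transition_setup V p "return_pmf x" "N x" "Y x" N Y A B
    by (rule Y_setup)
  show ?thesis
    by (simp add: return_prob_def committor_def hitting_time_less_iff Y.prob_hits_before_swap)
qed

lemma return_prob_A:
  assumes x: "x \<in> A"
  shows "return_prob x = 1"
proof -
  interpret Y: finite_chain V p "return_pmf x" "N x" "Y x"
    using x A_subset by (intro finite_chain_Y) blast
  have "AE \<omega> in N x. hits_before A B (\<lambda>i. Y x i \<omega>)"
    using Y.AE_X_0
    by eventually_elim (use x disjoint in \<open>auto simp: hits_before_def intro!: exI[of _ 0]\<close>)
  then show ?thesis
    unfolding return_prob_def by (subst Y.prob_Collect_eq_1) auto
qed

lemma return_prob_B:
  assumes x: "x \<in> B"
  shows "return_prob x = 0"
proof -
  interpret Y: finite_chain V p "return_pmf x" "N x" "Y x"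
    using x B_subset by (intro finite_chain_Y) blast
  have "AE \<omega> in N x. \<not> hits_before A B (\<lambda>i. Y x i \<omega>)"
    using Y.AE_X_0 by eventually_elim (use x in \<open>auto simp: hits_before_def\<close>)
  then show ?thesis
    unfolding return_prob_def by (subst Y.prob_Collect_eq_0) auto
qed

text \<open>Jumping from \<open>y\<close> to \<open>x\<close> and then hitting \<open>A\<close>
  before \<open>B\<close> is one way to do so from \<open>y\<close>, since \<open>y\<close> itself
  is not in \<open>B\<close>. Hence a state with return probability zero jumps only to states of the
  same kind.\<close>

lemma return_prob_step_le:
  assumes x: "x \<in> V" and y: "y \<in> V - B"
  shows "pmf (p y) x * return_prob x \<le> return_prob y"
proof -
  interpret Y: transition_setup V p "return_pmf y" "N y" "Y y" N Y A B
    using y by (intro Y_setup) simp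
  interpret Yx: restarted_chain V p "return_pmf y" "N y" "Y y" x "N x" "Y x"
    by (rule Y.restarted[OF x])
  \<comment> \<open>\<open>E1\<close> keeps the starting point as part of the past, so that the
    Markov property can be used at time \<open>1\<close>.\<close>
  have E0: "determined_by 0 (\<lambda>_. True)" and E1: "determined_by 1 (\<lambda>w. w 0 = y)"
    by (simp_all add: determined_by_def)
  have "pmf (p y) x = \<P>(\<omega> in N y. Y y 0 \<omega> = y \<and> Y y 1 \<omega> = x)"
    using Y.prob_step[OF E0, of y x] Y.prob_X_0[of y] x y by simp
  then have "pmf (p y) x * return_prob x = \<P>(\<omega> in N y. (Y y 0 \<omega> = y \<and> Y y 1 \<omega> = x) \<and>
      hits_before A B (\<lambda>i. Y y (1 + i) \<omega>))"
    unfolding return_prob_def Yx.markov_property_hits_before[OF E1] by simp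
  also have "\<dots> \<le> return_prob y"
    unfolding return_prob_def
  proof (rule Y.finite_measure_mono)
    show "{\<omega> \<in> space (N y). (Y y 0 \<omega> = y \<and> Y y 1 \<omega> = x) \<and> hits_before A B (\<lambda>i. Y y (1 + i) \<omega>)}
        \<subseteq> {\<omega> \<in> space (N y). hits_before A B (\<lambda>i. Y y i \<omega>)}"
    proof
      fix \<omega> assume "\<omega> \<in> {\<omega> \<in> space (N y). (Y y 0 \<omega> = y \<and> Y y 1 \<omega> = x) \<and>
        hits_before A B (\<lambda>i. Y y (1 + i) \<omega>)}"
      then have \<omega>: "\<omega> \<in> space (N y)" and y0: "Y y 0 \<omega> = y"
        and "hits_before A B (\<lambda>i. Y y (1 + i) \<omega>)"
        by auto
      then obtain m where m: "Y y (Suc m) \<omega> \<in> A" "\<forall>i\<le>m. Y y (Suc i) \<omega> \<notin> B"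
        unfolding hits_before_def by auto
      have "Y y i \<omega> \<notin> B" if "i \<le> Suc m" for i
        using that m(2) y y0 by (cases i) auto
      with m \<omega> show "\<omega> \<in> {\<omega> \<in> space (N y). hits_before A B (\<lambda>i. Y y i \<omega>)}"
        unfolding hits_before_def by blast
    qed
  qed measurable
  finally show ?thesis .
qed

section \<open>The Green function of the killed chain and nonreactive visits\<close>

definition occupation :: "'s \<Rightarrow> real" where
  "occupation x = (\<Sum>k. killed_prob k x)"

text \<open>The term at time \<open>0\<close> is the initial mass, and the forward equation rewrites
  all later ones. Summability of \<open>killed_prob\<close> allows the series and the finite sum
  over states to be exchanged.\<close>

lemma occupation_eq:
  assumes x: "x \<in> V - B"
  shows "occupation x = pmf \<nu> x + (\<Sum>y\<in>V - B. occupation y * pmf (p y) x)"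
proof -
  have "occupation x = killed_prob 0 x + (\<Sum>k. killed_prob (Suc k) x)"
    unfolding occupation_def using suminf_split_head[OF summable_killed_prob[of x]] by simp
  also have "(\<Sum>k. killed_prob (Suc k) x) = (\<Sum>k. \<Sum>y\<in>V. killed_prob k y * pmf (p y) x)"
    by (simp add: killed_prob_Suc[OF x])
  also have "\<dots> = (\<Sum>y\<in>V. \<Sum>k. killed_prob k y * pmf (p y) x)"
    by (intro suminf_sum summable_mult2 summable_killed_prob)
  also have "\<dots> = (\<Sum>y\<in>V. occupation y * pmf (p y) x)"
    by (simp add: occupation_def suminf_mult2 summable_killed_prob)
  also have "\<dots> = (\<Sum>y\<in>V - B. occupation y * pmf (p y) x)"
    by (intro sum.mono_neutral_right) (auto simp: finite_V occupation_def killed_prob_B)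
  finally show ?thesis
    by (simp add: killed_prob_0[OF x])
qed

text \<open>Almost surely the visit count is a series of indicators of \<open>?D l\<close>. The
  Markov property at time \<open>l\<close> factors each of them into surviving in \<open>x\<close>
  and returning from \<open>x\<close>, and the second factor does not depend on
  \<open>l\<close>.\<close>

lemma mean_nonreactive_visits_eq:
  assumes \<nu>: "set_pmf \<nu> \<subseteq> A" and x: "x \<in> V"
  shows "mean_nonreactive_visits A B M X x = occupation x * return_prob x"
proof -
  let ?D = "\<lambda>l \<omega>. ((\<forall>i\<le>l. X i \<omega> \<notin> B) \<and> X l \<omega> = x) \<and> hits_before A B (\<lambda>i. X (l + i) \<omega>)"
  interpret restarted_chain V p \<nu> M X x "N x" "Y x"
    by (rule restarted[OF x])
  have ae: "AE \<omega> in M. X 0 \<omega> \<in> A \<and> (\<exists>k. X k \<omega> \<in> B)"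
    using AE_X_0 AE_hits_B by eventually_elim (use \<nu> in blast)
  have prob_D: "(\<integral>\<omega>. of_bool (?D l \<omega>) \<partial>M) = killed_prob l x * return_prob x" for l
  proof -
    have "(\<integral>\<omega>. of_bool (?D l \<omega>) \<partial>M) =
        (\<integral>\<omega>. (indicator {\<omega> \<in> space M. ?D l \<omega>} \<omega> :: real) \<partial>M)"
      by (rule Bochner_Integration.integral_cong) (auto simp: indicator_def)
    also have "\<dots> = \<P>(\<omega> in M. ?D l \<omega>)"
      by simp
    also have "\<dots> = killed_prob l x * return_prob x"
      unfolding killed_prob_def return_prob_def
      by (rule markov_property_hits_before[OF determined_by_avoid])
    finally show ?thesis .
  qed
  have norm_of_bool: "norm (of_bool b :: real) = of_bool b" for b
    by simp
  have [measurable]: "(\<lambda>\<omega>. last_hitting_time A B (\<lambda>k. X k \<omega>)) \<in> measurable M (count_space UNIV)"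
    unfolding last_hitting_time_def less_hitting_time_iff by measurable
  have meas_ind [measurable]: "(\<lambda>\<omega>. indicator {x} (X l \<omega>) :: real) \<in> borel_measurable M" for l
    by (rule measurable_compose[OF X_measurable]) simp
  have "mean_nonreactive_visits A B M X x = (\<integral>\<omega>. (\<Sum>l. of_bool (?D l \<omega>)) \<partial>M)"
    unfolding mean_nonreactive_visits_def
  proof (rule integral_cong_AE)
    show "(\<lambda>\<omega>. \<Sum>l=0..last_hitting_time A B (\<lambda>k. X k \<omega>). indicator {x} (X l \<omega>) :: real)
        \<in> borel_measurable M"
      \<comment> \<open>The upper limit of the sum is random; measurability follows by splitting
        over its countably many values.\<close>
      by (rule measurable_compose_countable[where g = "\<lambda>\<omega>. last_hitting_time A B (\<lambda>k. X k \<omega>)"])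
        measurable
    show "(\<lambda>\<omega>. \<Sum>l. of_bool (?D l \<omega>) :: real) \<in> borel_measurable M"
      by measurable
    show "AE \<omega> in M. (\<Sum>l=0..last_hitting_time A B (\<lambda>k. X k \<omega>). indicator {x} (X l \<omega>)) =
        (\<Sum>l. of_bool (?D l \<omega>) :: real)"
      using ae
    proof eventually_elim
      case (elim \<omega>)
      then obtain k where "X 0 \<omega> \<in> A" "X k \<omega> \<in> B"
        by blast
      from sum_upto_last_hitting_time(1)[OF disjoint, where w = "\<lambda>i. X i \<omega>", OF this, of x]
      show ?case
        by (simp only: conj_assoc)
    qed
  qed
  also have "\<dots> = (\<Sum>l. \<integral>\<omega>. of_bool (?D l \<omega>) \<partial>M)"
  \<comment> \<open>Pathwise, only finitely many terms are nonzero once \<open>B\<close> is hit; the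
    integrals are summable because the killed chain has finite occupation.\<close>
  proof (rule integral_suminf)
    show "integrable M (\<lambda>\<omega>. of_bool (?D l \<omega>) :: real)" for l
      by (rule integrable_const_bound[where B = 1]) (auto, measurable)
    show "AE \<omega> in M. summable (\<lambda>l. norm (of_bool (?D l \<omega>) :: real))"
      using ae
    proof eventually_elim
      case (elim \<omega>)
      then obtain k where "X 0 \<omega> \<in> A" "X k \<omega> \<in> B"
        by blast
      from sum_upto_last_hitting_time(2)[OF disjoint, where w = "\<lambda>i. X i \<omega>", OF this, of x]
      have "finite {l. ?D l \<omega>}"
        by (simp only: conj_assoc)
      then show ?case
        by (rule summable_finite) simp
    qed
    show "summable (\<lambda>l. \<integral>\<omega>. norm (of_bool (?D l \<omega>) :: real) \<partial>M)"
      unfolding norm_of_bool prob_D by (intro summable_mult2 summable_killed_prob)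
  qed
  also have "\<dots> = occupation x * return_prob x"
    unfolding prob_D occupation_def by (rule suminf_mult2[symmetric, OF summable_killed_prob])
  finally show ?thesis .
qed

lemma mean_nonreactive_visits_recursion:
  defines "W \<equiv> {x \<in> V. return_prob x > 0}"
    and "\<theta> \<equiv> mean_nonreactive_visits A B M X"
  assumes \<nu>: "set_pmf \<nu> \<subseteq> A" and x: "x \<in> W"
  shows "\<theta> x = pmf \<nu> x * indicator A x +
    (\<Sum>y\<in>W. \<theta> y * (pmf (p y) x * return_prob x / return_prob y))"
proof -
  have W: "W \<subseteq> V - B"
    using return_prob_B by (force simp: W_def)
  with x have xV: "x \<in> V" "x \<in> V - B" "return_prob x > 0"
    by (auto simp: W_def)
  have "\<theta> x = pmf \<nu> x * return_prob x +
      (\<Sum>y\<in>V - B. occupation y * (pmf (p y) x * return_prob x))"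
    unfolding \<theta>_def mean_nonreactive_visits_eq[OF \<nu> xV(1)] occupation_eq[OF xV(2)]
    by (simp add: distrib_right sum_distrib_right mult.assoc)
  \<comment> \<open>On \<open>A\<close> the return probability is \<open>1\<close>; off
    \<open>A\<close> the initial mass is zero.\<close>
  also have "pmf \<nu> x * return_prob x = pmf \<nu> x * indicator A x"
    using \<nu> return_prob_A[of x] by (cases "x \<in> A") (auto simp: set_pmf_iff)
  also have "(\<Sum>y\<in>V - B. occupation y * (pmf (p y) x * return_prob x)) =
      (\<Sum>y\<in>W. occupation y * (pmf (p y) x * return_prob x))"
  \<comment> \<open>A state outside \<open>W\<close> has return probability zero, so the one-step
    bound makes its weight towards \<open>x\<close> vanish.\<close>
  proof (rule sum.mono_neutral_right[OF _ W], use finite_V in simp, safe)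
    fix y assume y: "y \<in> V" "y \<notin> B" "y \<notin> W"
    then have "pmf (p y) x * return_prob x \<le> 0"
      using return_prob_step_le[of x y] xV by (simp add: W_def)
    then have "pmf (p y) x * return_prob x = 0"
      using xV by (intro antisym) (auto intro: mult_nonneg_nonneg)
    then show "occupation y * (pmf (p y) x * return_prob x) = 0"
      by simp
  qed
  \<comment> \<open>On \<open>W\<close> the divisor is positive and cancels the return factor
    contained in \<open>\<theta> y\<close>.\<close>
  also have "\<dots> = (\<Sum>y\<in>W. \<theta> y * (pmf (p y) x * return_prob x / return_prob y))"
    by (rule sum.cong) (auto simp: \<theta>_def W_def mean_nonreactive_visits_eq[OF \<nu>])
  finally show ?thesis .
qed

end

theorem proposition3:
  fixes n :: nat and V A B Vminus :: "nat set"
    and p :: "nat \<Rightarrow> nat pmf" and \<mu> :: "nat pmf"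
    and M :: "'a measure" and X :: "nat \<Rightarrow> 'a \<Rightarrow> nat"
    and N :: "nat \<Rightarrow> 'b measure" and Y :: "nat \<Rightarrow> nat \<Rightarrow> 'b \<Rightarrow> nat"
    and q \<theta> :: "nat \<Rightarrow> real" and pbar :: "nat \<Rightarrow> nat \<Rightarrow> real"
  assumes "n > 1" and V: "V = {1..n}"
    and p: "\<And>x. x \<in> V \<Longrightarrow> set_pmf (p x) \<subseteq> V"
    and "A \<subseteq> V" "B \<subseteq> V" "A \<noteq> {}" "B \<noteq> {}" "A \<inter> B = {}"
    and \<mu>: "set_pmf \<mu> \<subseteq> A"
    and "V - (A \<union> B) \<noteq> {}"
    and "\<And>x. x \<in> V - (A \<union> B) \<Longrightarrow> reachable V p A B A x \<or> reachable V p A B B x"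
    and "\<And>x. x \<in> A \<Longrightarrow> reachable V p A B B x"
    and X: "markov_chain V p \<mu> M X"
    and Y: "\<And>x. x \<in> V \<Longrightarrow> markov_chain V p (return_pmf x) (N x) (Y x)"
    and q: "\<And>x. x \<in> V \<Longrightarrow> q x = committor A B N Y x"
    and Vminus: "Vminus = {x \<in> V. q x < 1}"
    and \<theta>: "\<And>x. x \<in> Vminus \<Longrightarrow> \<theta> x = mean_nonreactive_visits A B M X x"
    and pbar: "\<And>x y. x \<in> Vminus \<Longrightarrow> y \<in> Vminus \<Longrightarrow>
                 pbar x y = pmf (p y) x * (1 - q x) / (1 - q y)"
  shows "\<forall>x\<in>Vminus. \<theta> x = pmf \<mu> x * indicator A x + (\<Sum>y\<in>Vminus. \<theta> y * pbar x y)"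
proof -
  interpret transition_setup V p \<mu> M X N Y A B
    using assms by unfold_locales simp_all
  have return: "return_prob x = 1 - q x" if "x \<in> V" for x
    using return_prob_eq_committor[OF that] q[OF that] by simp
  have W: "{x \<in> V. return_prob x > 0} = Vminus"
    unfolding Vminus using return by auto
  have sub: "x \<in> V" if "x \<in> Vminus" for x
    using that by (simp add: Vminus)
  show ?thesis
  proof
    fix x assume x: "x \<in> Vminus"
    \<comment> \<open>Both return probabilities are \<open>1 - q\<close> here, which turns the
      weights into \<open>pbar\<close>.\<close>
    have "(\<Sum>y\<in>Vminus. mean_nonreactive_visits A B M X y *
        (pmf (p y) x * return_prob x / return_prob y)) = (\<Sum>y\<in>Vminus. \<theta> y * pbar x y)"
      using x by (intro sum.cong) (simp_all add: \<theta> pbar return sub)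
    with mean_nonreactive_visits_recursion[OF \<mu>, of x] x
    show "\<theta> x = pmf \<mu> x * indicator A x + (\<Sum>y\<in>Vminus. \<theta> y * pbar x y)"
      by (simp add: W \<theta>)
  qed
qed

end
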